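(* Let $\frac16\le a,b\le\frac56$, put $\rho=(\rho_1,\rho_2,\rho_3)=(-a,0,b)$ and, for $i=1,2,3$, $$z_i=\frac{2\rho_i}{1+\rho_i^2},\qquad u_i=\frac{\rho_i+\mathrm i}{\sqrt2},\qquad v_i=\frac{\rho_i-\mathrm i}{\sqrt2},$$ where $\mathrm i$ is the imaginary unit. Every Hermitian $3\times3$ complex matrix $L$ satisfying $$(1-\bar u_iu_j)_{ij}\circ L\succeq0,\qquad (1-\bar v_iv_j)_{ij}\circ L\succeq0$$ obeys $$(2-\bar z_iz_j)_{ij}\circ L\succeq0 .$$ (Hence the identity multiplier has norm at most $\sqrt2$ on the complete right-angle admissible-kernel cone for this two-parameter family.)
   Context: $\circ$ denotes the entrywise (Schur/Hadamard) product of matrices, and $\succeq0$ means positive semidefinite. The admissible-kernel cone is the set of Hermitian $L$ satisfying the two displayed hypotheses, and "the identity multiplier has norm at most $\sqrt2$" on it means that $(2-\bar z_iz_j)_{ij}\circ L\succeq0$ for all $L$ in it. *)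

theory Defs
  imports "HOL-Analysis.Analysis"
begin

definition hermitian :: "complex^'n^'n \<Rightarrow> bool" where
  "hermitian A \<longleftrightarrow> (\<forall>i j. A $ i $ j = cnj (A $ j $ i))"

definition psd :: "complex^'n^'n \<Rightarrow> bool" where
  "psd A \<longleftrightarrow> hermitian A \<and> (\<forall>x. 0 \<le> Re (\<Sum>i\<in>UNIV. cnj (x $ i) * (A *v x) $ i))"

definition schur_prod :: "complex^'n^'m \<Rightarrow> complex^'n^'m \<Rightarrow> complex^'n^'m"  (infixl "\<circ>\<^sub>S" 70) where
  "A \<circ>\<^sub>S B = (\<chi> i j. A $ i $ j * B $ i $ j)"

text \<open>The matrix with entries \<open>c - cnj (w\<^sub>i) w\<^sub>j\<close>.\<close>
definition defect_matrix :: "complex \<Rightarrow> complex^'n \<Rightarrow> complex^'n^'n" where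
  "defect_matrix c w = (\<chi> i j. c - cnj (w $ i) * w $ j)"

text \<open>In the index type \<^typ>\<open>3\<close> the third index is the numeral \<open>3 = 0\<close>;
  \<^const>\<open>vector\<close> lists the components at the indices 1, 2, 3 in this order.\<close>
definition rho :: "real \<Rightarrow> real \<Rightarrow> real^3" where
  "rho a b = vector [- a, 0, b]"

definition z_node :: "real \<Rightarrow> real \<Rightarrow> complex^3" where
  "z_node a b = (\<chi> i. complex_of_real (2 * rho a b $ i / (1 + (rho a b $ i)\<^sup>2)))"

definition u_node :: "real \<Rightarrow> real \<Rightarrow> complex^3" where
  "u_node a b = (\<chi> i. (complex_of_real (rho a b $ i) + \<i>) / complex_of_real (sqrt 2))"

definition v_node :: "real \<Rightarrow> real \<Rightarrow> complex^3" where
  "v_node a b = (\<chi> i. (complex_of_real (rho a b $ i) - \<i>) / complex_of_real (sqrt 2))"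

definition admissible_kernels :: "real \<Rightarrow> real \<Rightarrow> (complex^3^3) set" where
  "admissible_kernels a b =
     {L. hermitian L \<and> psd (defect_matrix 1 (u_node a b) \<circ>\<^sub>S L)
                     \<and> psd (defect_matrix 1 (v_node a b) \<circ>\<^sub>S L)}"

text \<open>The multiplier taking the values \<open>w\<^sub>i\<close> at the nodes has norm at most \<open>c\<close> on the
  set \<open>K\<close> of kernels; the identity multiplier takes the values \<open>z\<^sub>i\<close>.\<close>
definition multiplier_norm_le :: "(complex^'n^'n) set \<Rightarrow> complex^'n \<Rightarrow> real \<Rightarrow> bool" where
  "multiplier_norm_le K w c \<longleftrightarrow>
     (\<forall>L\<in>K. psd (defect_matrix (complex_of_real (c\<^sup>2)) w \<circ>\<^sub>S L))"

end

theory Submission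
  imports Defs
begin

text \<open>
  Write \<open>n\<^sub>i = (1 + \<rho>\<^sub>i\<^sup>2) / 2\<close>. Since \<open>\<rho>\<^sub>i\<close> is real, \<open>v\<^sub>i\<close> is the conjugate of \<open>u\<^sub>i\<close> and
  \<open>u\<^sub>i v\<^sub>i = n\<^sub>i\<close>. The theorem rests on the identity

  \<open>2 - cnj z\<^sub>i z\<^sub>j = (1 - cnj u\<^sub>i u\<^sub>j) / (cnj v\<^sub>i v\<^sub>j) + (1 - cnj v\<^sub>i v\<^sub>j) / (cnj u\<^sub>i u\<^sub>j) + q\<^sub>i q\<^sub>j\<close>,
  where \<open>q\<^sub>i = \<rho>\<^sub>i\<^sup>2 / n\<^sub>i\<close>,

  which is \<open>defect_identity\<close> below. Taken entrywise against \<open>L\<close>, it writes the target as a sum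
  of three matrices. The first two are diagonal congruences of the two
  hypotheses and hence positive semidefinite. The third is a diagonal congruence of \<open>L\<close>, and
  \<open>L\<close> is itself positive semidefinite: \<open>|u\<^sub>i|\<^sup>2 = n\<^sub>i < 1\<close>, so \<open>L\<close> is the Schur product of
  \<open>(1 - cnj u\<^sub>i u\<^sub>j) \<circ> L\<close> with the Szego kernel \<open>1 / (1 - cnj u\<^sub>i u\<^sub>j)\<close>, a sum of
  the rank-one kernels \<open>(cnj u\<^sub>i u\<^sub>j)\<^sup>k\<close>. This last step is \<open>psd_if_psd_defect\<close>.

  The identity can be found by duality: the target holds for every admissible \<open>L\<close> as soon as the
  matrix \<open>2 - cnj z\<^sub>i z\<^sub>j\<close> is a combination of the two defect matrices with positive semidefinite
  Schur coefficients. The coefficients here are a rank-one matrix plus a multiple of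
  \<open>\<rho>\<^sub>i\<^sup>2 \<rho>\<^sub>j\<^sup>2 / (1 - \<rho>\<^sub>i \<rho>\<^sub>j)\<close>, up to diagonal scaling.
\<close>

lemma psd_iff_quadratic_form:
  "psd A \<longleftrightarrow> hermitian A \<and> (\<forall>x. 0 \<le> Re (\<Sum>i\<in>UNIV. \<Sum>j\<in>UNIV. cnj (x $ i) * A $ i $ j * x $ j))"
  by (simp add: psd_def matrix_vector_mult_def sum_distrib_left mult.assoc)

lemma psd_add:
  assumes "psd A" "psd B"
  shows "psd (A + B)"
proof -
  have "hermitian (A + B)"
    unfolding hermitian_def
  proof (intro allI)
    fix i j
    have "A $ i $ j = cnj (A $ j $ i)" "B $ i $ j = cnj (B $ j $ i)"
      using assms unfolding psd_def hermitian_def by blast+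
    then show "(A + B) $ i $ j = cnj ((A + B) $ j $ i)" by simp
  qed
  moreover have "0 \<le> Re (\<Sum>i\<in>UNIV. \<Sum>j\<in>UNIV. cnj (x $ i) * (A + B) $ i $ j * x $ j)" for x
  proof -
    have "0 \<le> Re (\<Sum>i\<in>UNIV. \<Sum>j\<in>UNIV. cnj (x $ i) * A $ i $ j * x $ j)
          + Re (\<Sum>i\<in>UNIV. \<Sum>j\<in>UNIV. cnj (x $ i) * B $ i $ j * x $ j)"
      using assms unfolding psd_iff_quadratic_form by (intro add_nonneg_nonneg) blast+
    then show ?thesis by (simp add: distrib_left distrib_right sum.distrib)
  qed
  ultimately show ?thesis by (simp add: psd_iff_quadratic_form)
qed

lemma quadratic_form_congruence:
  fixes A :: "complex^'n^'n"
  shows "(\<Sum>i\<in>UNIV. \<Sum>j\<in>UNIV. cnj (x $ i) * (cnj (c $ i) * c $ j * A $ i $ j) * x $ j)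
       = (\<Sum>i\<in>UNIV. \<Sum>j\<in>UNIV. cnj ((\<chi> k. c $ k * x $ k) $ i) * A $ i $ j * (\<chi> k. c $ k * x $ k) $ j)"
  by (simp add: mult_ac)

lemma psd_diagonal_congruence:
  fixes A :: "complex^'n^'n"
  assumes "psd A"
  shows "psd (\<chi> i j. cnj (c $ i) * c $ j * A $ i $ j)"
proof -
  have "hermitian A" using assms by (simp add: psd_def)
  then have "cnj (A $ j $ i) = A $ i $ j" for i j
    unfolding hermitian_def by metis
  then have "hermitian (\<chi> i j. cnj (c $ i) * c $ j * A $ i $ j)"
    by (simp add: hermitian_def mult_ac)
  moreover have "0 \<le> Re (\<Sum>i\<in>UNIV. \<Sum>j\<in>UNIV.
      cnj (x $ i) * (cnj (c $ i) * c $ j * A $ i $ j) * x $ j)" for x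
    unfolding quadratic_form_congruence using assms unfolding psd_iff_quadratic_form by blast
  ultimately show ?thesis by (simp add: psd_iff_quadratic_form)
qed

text \<open>
  With \<open>Q x\<close> the quadratic form of \<open>L\<close> and \<open>D = diag w\<close>, the hypothesis says
  \<open>Q x \<ge> Q (D x)\<close>. Iterating gives \<open>Q x \<ge> Q (D\<^sup>k x)\<close>, and \<open>D\<^sup>k x\<close> tends to 0.
\<close>
lemma psd_if_psd_defect:
  fixes L :: "complex^'n^'n" and w :: "complex^'n"
  assumes herm: "hermitian L" and defect: "psd (defect_matrix 1 w \<circ>\<^sub>S L)"
    and disc: "\<And>i. cmod (w $ i) < 1"
  shows "psd L"
proof -
  define Q where "Q x = Re (\<Sum>i\<in>UNIV. \<Sum>j\<in>UNIV. cnj (x $ i) * L $ i $ j * x $ j)"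
    for x :: "complex^'n"
  define D where "D k x = (\<chi> i. (w $ i) ^ k * x $ i)" for k and x :: "complex^'n"
  have step: "Q (D 1 x) \<le> Q x" for x
  proof -
    have "0 \<le> Re (\<Sum>i\<in>UNIV. \<Sum>j\<in>UNIV. cnj (x $ i) * ((1 - cnj (w $ i) * w $ j) * L $ i $ j) * x $ j)"
      using defect by (simp add: psd_iff_quadratic_form defect_matrix_def schur_prod_def)
    also have "\<dots> = Q x - Q (D 1 x)"
      unfolding Q_def D_def by (simp add: algebra_simps sum_subtractf)
    finally show ?thesis by simp
  qed
  have iterate: "Q (D k x) \<le> Q x" for k x
  proof (induction k)
    case 0
    have "D 0 x = x" by (simp add: D_def vec_eq_iff)
    then show ?case by simp
  next
    case (Suc k)
    have "D (Suc k) x = D 1 (D k x)" by (simp add: D_def vec_eq_iff)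
    then show ?case using step[of "D k x"] Suc by simp
  qed
  have "0 \<le> Q x" for x
  proof -
    have coord: "(\<lambda>k. D k x $ i) \<longlonglongrightarrow> 0" for i
      using tendsto_mult_right[OF LIMSEQ_power_zero[OF disc[of i]], of "x $ i"]
      by (simp add: D_def)
    have "(\<lambda>k. Q (D k x)) \<longlonglongrightarrow>
        Re (\<Sum>i\<in>UNIV. \<Sum>j\<in>UNIV. cnj 0 * L $ i $ j * 0)"
      unfolding Q_def by (intro tendsto_intros coord)
    then show ?thesis
      using iterate by (intro LIMSEQ_le_const2) auto
  qed
  with herm show ?thesis by (simp add: psd_iff_quadratic_form Q_def)
qed

text \<open>
  Multiplied by \<open>(1 + r\<^sup>2) (1 + t\<^sup>2) / 2\<close>, with \<open>p = r t\<close> and \<open>d = r - t\<close>, both sides are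
  \<open>1 + p\<^sup>2 + d\<^sup>2\<close>: the first two terms on the right are conjugates with sum
  \<open>Re ((1 + p + \<i> d) (1 - p - \<i> d)) = 1 - p\<^sup>2 + d\<^sup>2\<close>, and the last one is \<open>2 p\<^sup>2\<close>.
  The factor \<open>sqrt 2 (r + \<i>) / (1 + r\<^sup>2)\<close> is the reciprocal of \<open>(r - \<i>) / sqrt 2\<close>.
\<close>
lemma defect_identity:
  fixes r t :: real
  defines "\<alpha> \<equiv> \<lambda>s :: real. complex_of_real (sqrt 2) * (of_real s + \<i>) / of_real (1 + s\<^sup>2)"
    and "\<beta> \<equiv> \<lambda>s :: real. complex_of_real (sqrt 2) * (of_real s - \<i>) / of_real (1 + s\<^sup>2)"
    and "u \<equiv> \<lambda>s :: real. (complex_of_real s + \<i>) / complex_of_real (sqrt 2)"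
    and "v \<equiv> \<lambda>s :: real. (complex_of_real s - \<i>) / complex_of_real (sqrt 2)"
    and "q \<equiv> \<lambda>s :: real. complex_of_real (2 * s\<^sup>2 / (1 + s\<^sup>2))"
    and "z \<equiv> \<lambda>s :: real. complex_of_real (2 * s / (1 + s\<^sup>2))"
  shows "2 - cnj (z r) * z t
       = cnj (\<alpha> r) * \<alpha> t * (1 - cnj (u r) * u t)
       + cnj (\<beta> r) * \<beta> t * (1 - cnj (v r) * v t)
       + cnj (q r) * q t"
proof -
  define R T where "R = complex_of_real r" and "T = complex_of_real t"
  define N M where "N = 1 + R\<^sup>2" and "M = 1 + T\<^sup>2"
  have "1 + r\<^sup>2 \<noteq> 0" "1 + t\<^sup>2 \<noteq> 0" by (smt (verit) zero_le_power2)+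
  then have nz: "N \<noteq> 0" "M \<noteq> 0"
    unfolding N_def M_def R_def T_def by (metis of_real_1 of_real_add of_real_eq_0_iff of_real_power)+
  have sqrt2: "complex_of_real (sqrt 2) * complex_of_real (sqrt 2) = 2"
    by (simp flip: of_real_mult)
  have A: "cnj (\<alpha> r) * \<alpha> t = 2 * ((R - \<i>) * (T + \<i>)) / (N * M)"
    using sqrt2 by (simp add: \<alpha>_def R_def T_def N_def M_def mult_ac)
  have B: "cnj (\<beta> r) * \<beta> t = 2 * ((R + \<i>) * (T - \<i>)) / (N * M)"
    using sqrt2 by (simp add: \<beta>_def R_def T_def N_def M_def mult_ac)
  have u: "cnj (u r) * u t = (R - \<i>) * (T + \<i>) / 2"
    using sqrt2 by (simp add: u_def R_def T_def)
  have v: "cnj (v r) * v t = (R + \<i>) * (T - \<i>) / 2"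
    using sqrt2 by (simp add: v_def R_def T_def)
  have C: "cnj (q r) * q t = 4 * (R\<^sup>2 * T\<^sup>2) / (N * M)"
    by (simp add: q_def R_def T_def N_def M_def mult_ac)
  have Z: "cnj (z r) * z t = 4 * (R * T) / (N * M)"
    by (simp add: z_def R_def T_def N_def M_def mult_ac)
  have I: "\<i> * \<i> = -1" by simp
  have numerators: "2 * (N * M) - 4 * (R * T)
      = 2 * ((R - \<i>) * (T + \<i>)) * (1 - (R - \<i>) * (T + \<i>) / 2)
      + 2 * ((R + \<i>) * (T - \<i>)) * (1 - (R + \<i>) * (T - \<i>) / 2) + 4 * (R\<^sup>2 * T\<^sup>2)"
    unfolding N_def M_def using I by (simp add: power2_eq_square field_simps)
  have "2 - cnj (z r) * z t = (2 * (N * M) - 4 * (R * T)) / (N * M)"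
    using nz by (simp add: Z diff_divide_distrib)
  also have "\<dots> = 2 * ((R - \<i>) * (T + \<i>)) / (N * M) * (1 - (R - \<i>) * (T + \<i>) / 2)
      + 2 * ((R + \<i>) * (T - \<i>)) / (N * M) * (1 - (R + \<i>) * (T - \<i>) / 2)
      + 4 * (R\<^sup>2 * T\<^sup>2) / (N * M)"
    unfolding numerators by (simp only: add_divide_distrib times_divide_eq_left)
  finally show ?thesis unfolding A B C u v .
qed

text \<open>
  The target nodes \<open>z\<^sub>i\<close> are \<open>sqrt 2\<close> times the average of \<open>1 / u\<^sub>i\<close> and \<open>1 / v\<^sub>i\<close>, which is why the weights
  \<open>1 / v\<^sub>i\<close> and \<open>1 / u\<^sub>i\<close> are the natural ones on the two hypotheses.
\<close>
lemma psd_defect_2_real_nodes: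
  fixes L :: "complex^'n^'n" and \<rho> :: "real^'n"
  assumes herm: "hermitian L" and bound: "\<And>i. \<bar>\<rho> $ i\<bar> < 1"
    and U: "psd (defect_matrix 1 (\<chi> i. (complex_of_real (\<rho> $ i) + \<i>) / complex_of_real (sqrt 2)) \<circ>\<^sub>S L)"
    and V: "psd (defect_matrix 1 (\<chi> i. (complex_of_real (\<rho> $ i) - \<i>) / complex_of_real (sqrt 2)) \<circ>\<^sub>S L)"
  shows "psd (defect_matrix 2 (\<chi> i. complex_of_real (2 * \<rho> $ i / (1 + (\<rho> $ i)\<^sup>2))) \<circ>\<^sub>S L)"
proof -
  define \<alpha> \<beta> q u v z where
    "\<alpha> = (\<chi> i. complex_of_real (sqrt 2) * (of_real (\<rho> $ i) + \<i>) / of_real (1 + (\<rho> $ i)\<^sup>2))"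
    and "\<beta> = (\<chi> i. complex_of_real (sqrt 2) * (of_real (\<rho> $ i) - \<i>) / of_real (1 + (\<rho> $ i)\<^sup>2))"
    and "q = (\<chi> i. complex_of_real (2 * (\<rho> $ i)\<^sup>2 / (1 + (\<rho> $ i)\<^sup>2)))"
    and "u = (\<chi> i. (complex_of_real (\<rho> $ i) + \<i>) / complex_of_real (sqrt 2))"
    and "v = (\<chi> i. (complex_of_real (\<rho> $ i) - \<i>) / complex_of_real (sqrt 2))"
    and "z = (\<chi> i. complex_of_real (2 * \<rho> $ i / (1 + (\<rho> $ i)\<^sup>2)))"
  note node_defs = \<alpha>_def \<beta>_def q_def u_def v_def z_def
  have U': "psd (defect_matrix 1 u \<circ>\<^sub>S L)" and V': "psd (defect_matrix 1 v \<circ>\<^sub>S L)"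
    using U V by (simp_all only: u_def v_def)
  have "psd L"
  proof (rule psd_if_psd_defect[OF herm U'])
    fix i
    have "(\<rho> $ i)\<^sup>2 < 1" using bound[of i] by (simp add: abs_square_less_1)
    then show "cmod (u $ i) < 1"
      by (simp add: u_def cmod_def power_divide)
  qed
  then have "psd ((\<chi> i j. cnj (\<alpha> $ i) * \<alpha> $ j * (defect_matrix 1 u \<circ>\<^sub>S L) $ i $ j)
      + (\<chi> i j. cnj (\<beta> $ i) * \<beta> $ j * (defect_matrix 1 v \<circ>\<^sub>S L) $ i $ j)
      + (\<chi> i j. cnj (q $ i) * q $ j * L $ i $ j))"
    (is "psd ?sum")
    by (intro psd_add psd_diagonal_congruence U' V')
  also have "?sum = defect_matrix 2 z \<circ>\<^sub>S L"
  proof -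
    have "2 - cnj (z $ i) * z $ j
        = cnj (\<alpha> $ i) * \<alpha> $ j * (1 - cnj (u $ i) * u $ j)
        + cnj (\<beta> $ i) * \<beta> $ j * (1 - cnj (v $ i) * v $ j) + cnj (q $ i) * q $ j" for i j
      unfolding node_defs vec_lambda_beta by (rule defect_identity)
    then show ?thesis
      by (simp add: vec_eq_iff schur_prod_def defect_matrix_def distrib_right mult.assoc)
  qed
  finally show ?thesis by (simp only: z_def)
qed

theorem theorem8p4:
  fixes a b :: real
  assumes "1/6 \<le> a" "a \<le> 5/6" "1/6 \<le> b" "b \<le> 5/6"
  shows "(\<forall>L :: complex^3^3.
            hermitian L \<longrightarrow>
            psd (defect_matrix 1 (u_node a b) \<circ>\<^sub>S L) \<longrightarrow>
            psd (defect_matrix 1 (v_node a b) \<circ>\<^sub>S L) \<longrightarrow>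
            psd (defect_matrix 2 (z_node a b) \<circ>\<^sub>S L))
         \<and> multiplier_norm_le (admissible_kernels a b) (z_node a b) (sqrt 2)"
proof -
  have "\<forall>i. \<bar>rho a b $ i\<bar> < 1"
    using assms by (simp add: forall_3 rho_def)
  then have "psd (defect_matrix 2 (z_node a b) \<circ>\<^sub>S L)"
    if "hermitian L" "psd (defect_matrix 1 (u_node a b) \<circ>\<^sub>S L)"
      "psd (defect_matrix 1 (v_node a b) \<circ>\<^sub>S L)" for L :: "complex^3^3"
    using psd_defect_2_real_nodes[of L "rho a b"] that
    unfolding u_node_def v_node_def z_node_def by blast
  then show ?thesis
    by (simp add: multiplier_norm_le_def admissible_kernels_def)
qed

end
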